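(* For integers $n\ge k\ge 1$ and $m\ge 0$, let $D(n,k,m)$ be the number of partitions of $n$ into $k$ distinct parts which have exactly $m$ sequences of odd length. Let $A_1(n,k,m)$ be the number of partitions $\lambda$ of $n$ into odd parts such that $\mathrm{Dur}_2(\lambda)=k$, $\lambda$ is of type I, and $\mathrm{dur}_2(\lambda)=m$; and let $A_2(n,k,m)$ be the number of partitions $\lambda$ of $n$ into odd parts such that $\mathrm{Dur}_2(\lambda)=k$, $\lambda$ is of type II, and $\mathrm{dur}_2(\lambda)=m$. Then \[ A_1(n,k,m)=D(n,2k,2m),\qquad A_2(n,k,m)=D(n,2k-1,2m+1). \]
   Context: For a partition into distinct parts, a "sequence" is a maximal run of parts forming consecutive integers (e.g. $7+6+5+2+1$ has sequences $(7,6,5)$ and $(2,1)$); its length is the number of parts in it. For a partition $\lambda=(\lambda_1\ge\lambda_2\ge\cdots\ge\lambda_\ell)$ into odd parts, set $\lambda_i=0$ for $i>\ell$. Its 2-modular Durfee side is $\mathrm{Dur}_2(\lambda)=\max\{i\ge 1:\lambda_i\ge 2i-1\}$ (and $0$ if $\lambda$ is empty); equivalently, it is the side of the largest square fitting in the 2-modular Ferrers diagram of $\lambda$, in which a part $2a+1$ is a row of $a+1$ cells. If $k=\mathrm{Dur}_2(\lambda)\ge1$, $\lambda$ is of type I if $\lambda_k>2k-1$ and of type II if $\lambda_k=2k-1$. The 2-modular sub-Durfee side $\mathrm{dur}_2(\lambda)$ is defined as follows: if $\lambda$ is of type I, $\mathrm{dur}_2(\lambda)$ is the largest $m\ge 0$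 such that $m=0$ or $\lambda_{k+m}\ge 2m-1$ (the 2-modular Durfee side of the partition $(\lambda_{k+1},\lambda_{k+2},\dots)$ below the Durfee square); if $\lambda$ is of type II, $\mathrm{dur}_2(\lambda)$ is the largest $j\ge0$ such that $j=0$ or $\lambda_{k+j}\ge 2j+1$ (i.e. the largest $j$ such that a $j$ (rows) by $j+1$ (columns) rectangle fits into the 2-modular diagram of $(\lambda_{k+1},\lambda_{k+2},\dots)$, and $0$ if none). *)

theory Defs
  imports Main
begin

definition partitions_of :: "nat \<Rightarrow> nat list set" where
  "partitions_of n = {xs. sorted_wrt (\<ge>) xs \<and> (\<forall>p\<in>set xs. 0 < p) \<and> sum_list xs = n}"

lemma finite_partitions_of: "finite (partitions_of n)"
proof -
  have len: "length xs \<le> sum_list xs" if "\<forall>p\<in>set xs. 0 < p" for xs :: "nat list"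
    using that by (induction xs) auto
  have "partitions_of n \<subseteq> {xs. set xs \<subseteq> {..n} \<and> length xs \<le> n}"
    using len by (auto simp: partitions_of_def member_le_sum_list)
  then show ?thesis
    by (rule finite_subset) (simp add: finite_lists_length_le)
qed

definition distinct_partitions_of :: "nat \<Rightarrow> nat list set" where
  "distinct_partitions_of n = {xs \<in> partitions_of n. distinct xs}"

definition odd_partitions_of :: "nat \<Rightarrow> nat list set" where
  "odd_partitions_of n = {xs \<in> partitions_of n. \<forall>p\<in>set xs. odd p}"

definition consecutive_run :: "nat set \<Rightarrow> bool" where
  "consecutive_run I \<longleftrightarrow> (\<exists>a b. a \<le> b \<and> I = {a..b})"

text \<open>The sequences of a partition into distinct parts are the maximal runs in its set of
  parts; the length of a sequence is its cardinality.\<close>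

definition part_sequences :: "nat list \<Rightarrow> nat set set" where
  "part_sequences xs = {I. consecutive_run I \<and> I \<subseteq> set xs \<and>
     (\<forall>J. consecutive_run J \<and> I \<subseteq> J \<and> J \<subseteq> set xs \<longrightarrow> J = I)}"

definition D :: "nat \<Rightarrow> nat \<Rightarrow> nat \<Rightarrow> nat" where
  "D n k m = card {xs \<in> distinct_partitions_of n.
     length xs = k \<and> card {I \<in> part_sequences xs. odd (card I)} = m}"

text \<open>Parts are indexed from 1, and are 0 beyond the number of parts.\<close>

definition part :: "nat list \<Rightarrow> nat \<Rightarrow> nat" where
  "part xs i = (if 1 \<le> i \<and> i \<le> length xs then xs ! (i - 1) else 0)"

definition Dur2 :: "nat list \<Rightarrow> nat" where
  "Dur2 xs = (if xs = [] then 0 else Max {i. 1 \<le> i \<and> part xs i \<ge> 2 * i - 1})"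

definition type_I :: "nat list \<Rightarrow> bool" where
  "type_I xs \<longleftrightarrow> Dur2 xs \<ge> 1 \<and> part xs (Dur2 xs) > 2 * Dur2 xs - 1"

definition type_II :: "nat list \<Rightarrow> bool" where
  "type_II xs \<longleftrightarrow> Dur2 xs \<ge> 1 \<and> part xs (Dur2 xs) = 2 * Dur2 xs - 1"

text \<open>The empty partition has neither type; the value 0 chosen for it is immaterial.\<close>

definition sub_dur2 :: "nat list \<Rightarrow> nat" where
  "sub_dur2 xs =
    (if type_I xs then Max {m. m = 0 \<or> part xs (Dur2 xs + m) \<ge> 2 * m - 1}
     else if type_II xs then Max {j. j = 0 \<or> part xs (Dur2 xs + j) \<ge> 2 * j + 1}
     else 0)"

definition A1 :: "nat \<Rightarrow> nat \<Rightarrow> nat \<Rightarrow> nat" where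
  "A1 n k m = card {xs \<in> odd_partitions_of n. Dur2 xs = k \<and> type_I xs \<and> sub_dur2 xs = m}"

definition A2 :: "nat \<Rightarrow> nat \<Rightarrow> nat \<Rightarrow> nat" where
  "A2 n k m = card {xs \<in> odd_partitions_of n. Dur2 xs = k \<and> type_II xs \<and> sub_dur2 xs = m}"

end

theory Submission
  imports "HOL-Computational_Algebra.Formal_Power_Series" "HOL-Library.Multiset" Defs
begin

text \<open>Both sides have the same generating function, computed by elementary decompositions. Put
  \<open>h = k\<close>, \<open>e = 0\<close> for the first identity and \<open>h = k - 1\<close>, \<open>e = 1\<close> for the second.

  Subtracting a staircase from a partition into \<open>2h + e\<close> distinct parts turns its sequences into the
  repeated values of a weakly decreasing list, zeros included. Splitting off pairs of equal
  entries leaves \<open>2m + e\<close> distinct entries and \<open>h - m\<close> pairs, so up to a power of \<open>q\<close> the generating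
  function is \<open>1 / ((q; q)_{2m+e} (q\<^sup>2; q\<^sup>2)_{h-m})\<close>.

  Cutting a partition into odd parts along its Durfee square and its sub-Durfee rectangle gives
  \<open>1 / (q\<^sup>2; q\<^sup>2)_h\<close> from the right of the square, a Gaussian binomial coefficient \<open>h\<close> over \<open>m\<close> in
  \<open>q\<^sup>2\<close> from the right of the rectangle, and \<open>1 / (q; q\<^sup>2)_{m+e}\<close> from below it. The product is the
  same because \<open>(q; q)_{2m+e} = (q\<^sup>2; q\<^sup>2)_m (q; q\<^sup>2)_{m+e}\<close>.\<close>

section \<open>Generating functions of weighted sets\<close>

text \<open>\<open>card\<close> of an infinite set is 0, so a coefficient is meaningful only when
  the level \<open>{x \<in> S. w x = n}\<close> is finite; hence the finiteness assumptions of
  \<open>gf_Un\<close> and \<open>gf_Times\<close>.\<close>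

definition gf :: "('a \<Rightarrow> nat) \<Rightarrow> 'a set \<Rightarrow> int fps" where
  "gf w S = Abs_fps (\<lambda>n. int (card {x \<in> S. w x = n}))"

lemma gf_nth: "fps_nth (gf w S) n = int (card {x \<in> S. w x = n})"
  by (simp add: gf_def)

lemma gf_empty [simp]: "gf w {} = 0"
  by (simp add: fps_eq_iff gf_nth)

lemma gf_singleton: "gf w {a} = fps_X ^ w a"
proof -
  have "{x \<in> {a}. w x = n} = (if w a = n then {a} else {})" for n by auto
  then show ?thesis by (auto simp: fps_eq_iff gf_nth)
qed

lemma gf_bij:
  assumes "bij_betw f S T" and "\<And>x. x \<in> S \<Longrightarrow> v (f x) = w x + c"
  shows "gf v T = fps_X ^ c * gf w S"
proof -
  \<comment> \<open>The case \<open>n < c\<close> is separate because the truncated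
    \<open>n - c\<close> would then select level 0 of \<open>S\<close>, whereas level
    \<open>n\<close> of \<open>T\<close> is empty.\<close>
  have "card {y \<in> T. v y = n} = (if n < c then 0 else card {x \<in> S. w x = n - c})" for n
  proof (cases "n < c")
    case True
    have "{y \<in> T. v y = n} = {}"
      using assms True by (auto simp: bij_betw_def)
    then show ?thesis using True by (simp only: card.empty if_True)
  next
    case False
    have "{y \<in> T. v y = n} = f ` {x \<in> S. w x = n - c}"
      using assms False by (auto simp: bij_betw_def)
    moreover have "inj_on f {x \<in> S. w x = n - c}"
      using assms(1) by (auto simp: bij_betw_def inj_on_def)
    ultimately show ?thesis using False by (simp add: card_image)
  qed
  then show ?thesis by (simp add: fps_eq_iff gf_nth fps_X_power_mult_nth)
qed

lemma gf_Un:
  assumes "S \<inter> T = {}" and "\<And>n. finite {x \<in> S \<union> T. w x = n}"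
  shows "gf w (S \<union> T) = gf w S + gf w T"
proof -
  have "card {x \<in> S \<union> T. w x = n} = card {x \<in> S. w x = n} + card {x \<in> T. w x = n}" for n
  proof -
    have "{x \<in> S \<union> T. w x = n} = {x \<in> S. w x = n} \<union> {x \<in> T. w x = n}" by auto
    moreover have "finite {x \<in> S. w x = n}" "finite {x \<in> T. w x = n}"
      by (rule finite_subset[OF _ assms(2)[of n]]; auto)+
    moreover have "{x \<in> S. w x = n} \<inter> {x \<in> T. w x = n} = {}" using assms(1) by auto
    ultimately show ?thesis by (simp add: card_Un_disjoint)
  qed
  then show ?thesis by (simp add: fps_eq_iff gf_nth)
qed

text \<open>Cauchy product: level \<open>n\<close> of \<open>S \<times> T\<close> is the disjoint
  union, over the weight \<open>i\<close> of the first component, of products of a level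
  \<open>i\<close> and a level \<open>n - i\<close>.\<close>

lemma gf_Times:
  assumes "\<And>n. finite {x \<in> S. w x = n}" and "\<And>n. finite {y \<in> T. v y = n}"
  shows "gf (\<lambda>(x, y). w x + v y) (S \<times> T) = gf w S * gf v T"
proof -
  have "card {p \<in> S \<times> T. (\<lambda>(x, y). w x + v y) p = n} =
      (\<Sum>i = 0..n. card {x \<in> S. w x = i} * card {y \<in> T. v y = n - i})" for n
  proof -
    have "{p \<in> S \<times> T. (\<lambda>(x, y). w x + v y) p = n} =
        (\<Union>i \<in> {0..n}. {x \<in> S. w x = i} \<times> {y \<in> T. v y = n - i})" by auto
    moreover have "card \<dots> = (\<Sum>i = 0..n. card ({x \<in> S. w x = i} \<times> {y \<in> T. v y = n - i}))"
      by (rule card_UN_disjoint) (auto intro: assms)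
    ultimately show ?thesis by (simp add: card_cartesian_product)
  qed
  then show ?thesis by (simp add: fps_eq_iff gf_nth fps_mult_nth)
qed

section \<open>Weakly decreasing lists\<close>

text \<open>Entries may be 0: a member is a partition into at most \<open>r\<close> parts, padded
  with zeros to length exactly \<open>r\<close>.\<close>

definition dec_lists :: "nat \<Rightarrow> nat list set" where
  "dec_lists r = {xs. sorted_wrt (\<ge>) xs \<and> length xs = r}"

definition box_lists :: "nat \<Rightarrow> nat \<Rightarrow> nat list set" where
  "box_lists r t = {xs \<in> dec_lists r. \<forall>x\<in>set xs. x \<le> t}"

definition odd_lists :: "nat \<Rightarrow> nat list set" where
  "odd_lists c = {xs. sorted_wrt (\<ge>) xs \<and> (\<forall>x\<in>set xs. odd x \<and> x < 2 * c)}"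

text \<open>The q-Pochhammer symbol \<open>(q^s; q^s)_r\<close> with
  \<open>q = fps_X\<close>.\<close>

definition qfact :: "nat \<Rightarrow> nat \<Rightarrow> int fps" where
  "qfact s r = (\<Prod>i<r. 1 - fps_X ^ (s * Suc i))"

lemma qfact_0 [simp]: "qfact s 0 = 1"
  and qfact_Suc: "qfact s (Suc r) = qfact s r * (1 - fps_X ^ (s * Suc r))"
  by (simp_all add: qfact_def)

lemma finite_level_dec_lists:
  assumes "0 < s" shows "finite {xs \<in> dec_lists r. s * sum_list xs = n}"
proof (rule finite_subset)
  show "{xs \<in> dec_lists r. s * sum_list xs = n} \<subseteq> {xs. set xs \<subseteq> {..n} \<and> length xs = r}"
  proof (clarsimp simp: dec_lists_def subset_iff)
    fix xs :: "nat list" and x assume "x \<in> set xs"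
    then have "x \<le> sum_list xs" by (simp add: member_le_sum_list)
    also have "\<dots> \<le> s * sum_list xs" using assms by simp
    finally show "x \<le> s * sum_list xs" .
  qed
qed (simp add: finite_lists_length_eq)

lemma finite_level_odd_lists: "finite {xs \<in> odd_lists c. sum_list xs = n}"
  by (rule finite_subset[OF _ finite_partitions_of[of n]])
    (auto simp: odd_lists_def partitions_of_def intro!: odd_pos)

lemma map_Suc_pred: "(\<forall>x\<in>set xs. 0 < x) \<Longrightarrow> map (Suc \<circ> (\<lambda>x. x - 1)) xs = xs"
  by (induction xs) auto

section \<open>Recursions of q-Pascal type and the resulting product formulas\<close>

lemma dec_snoc_or_positive:
  assumes "sorted_wrt (\<ge>) xs" and "length xs = Suc r"
  obtains ys where "xs = ys @ [0::nat]" | "\<forall>x\<in>set xs. 0 < x"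
proof (cases xs rule: rev_cases)
  case Nil
  then show ?thesis using assms by simp
next
  case (snoc ys y)
  then show ?thesis
    using assms that by (cases y) (force simp: sorted_wrt_append)+
qed

lemma sum_list_map_Suc: "sum_list (map Suc xs) = sum_list xs + length xs"
  by (induction xs) auto

lemma gf_snoc_zero_Un_map_Suc:
  assumes "0 < s" and "T \<subseteq> dec_lists (Suc r)"
    and T: "T = (\<lambda>ys. ys @ [0]) ` S \<union> map Suc ` R"
  shows "gf (\<lambda>xs. s * sum_list xs) T = gf (\<lambda>xs. s * sum_list xs) S +
    fps_X ^ (s * Suc r) * gf (\<lambda>xs. s * sum_list xs) R"
proof -
  let ?A = "(\<lambda>ys. ys @ [0]) ` S" and ?B = "map Suc ` R"
  have len: "length xs = Suc r" if "xs \<in> R" for xs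
    using that assms(2) by (force simp: T dec_lists_def)
  have "?A \<inter> ?B = {}"
  proof -
    have "0 \<in> set xs" if "xs \<in> ?A" for xs using that by auto
    moreover have "0 \<notin> set xs" if "xs \<in> ?B" for xs using that by auto
    ultimately show ?thesis by blast
  qed
  moreover have "finite {x \<in> ?A \<union> ?B. s * sum_list x = n}" for n
    using assms(2) unfolding T
    by (intro finite_subset[OF _ finite_level_dec_lists[OF assms(1), of "Suc r" n]]) blast
  ultimately have "gf (\<lambda>xs. s * sum_list xs) T =
      gf (\<lambda>xs. s * sum_list xs) ?A + gf (\<lambda>xs. s * sum_list xs) ?B"
    unfolding T by (rule gf_Un)
  moreover have "gf (\<lambda>xs. s * sum_list xs) ?A = fps_X ^ 0 * gf (\<lambda>xs. s * sum_list xs) S"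
    by (rule gf_bij[OF inj_on_imp_bij_betw]) (auto simp: inj_on_def)
  moreover have "gf (\<lambda>xs. s * sum_list xs) ?B =
      fps_X ^ (s * Suc r) * gf (\<lambda>xs. s * sum_list xs) R"
    by (rule gf_bij[OF inj_on_imp_bij_betw])
      (auto simp: inj_on_def sum_list_map_Suc len algebra_simps dest: map_injective)
  ultimately show ?thesis by simp
qed

lemma box_lists_Suc:
  "box_lists (Suc r) (Suc t) = (\<lambda>ys. ys @ [0]) ` box_lists r (Suc t) \<union> map Suc ` box_lists (Suc r) t"
  (is "_ = ?A \<union> ?B")
proof (intro equalityI subsetI)
  fix xs assume xs: "xs \<in> box_lists (Suc r) (Suc t)"
  then have "sorted_wrt (\<ge>) xs" "length xs = Suc r"
    by (auto simp: box_lists_def dec_lists_def)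
  then show "xs \<in> ?A \<union> ?B"
  proof (cases rule: dec_snoc_or_positive)
    case (1 ys)
    then show ?thesis
      using xs by (auto simp: box_lists_def dec_lists_def sorted_wrt_append)
  next
    case 2
    then have "xs = map Suc (map (\<lambda>x. x - 1) xs)" using map_Suc_pred[of xs] by simp
    moreover have "map (\<lambda>x. x - 1) xs \<in> box_lists (Suc r) t"
      using xs sorted_wrt_mono_rel[of xs "(\<ge>)" "\<lambda>x y. x - 1 \<ge> y - 1"]
      by (auto simp: box_lists_def dec_lists_def sorted_wrt_map)
    ultimately show ?thesis by blast
  qed
qed (auto simp: box_lists_def dec_lists_def sorted_wrt_append sorted_wrt_map)

lemma dec_lists_Suc:
  "dec_lists (Suc r) = (\<lambda>ys. ys @ [0]) ` dec_lists r \<union> map Suc ` dec_lists (Suc r)"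
  (is "_ = ?A \<union> ?B")
proof (intro equalityI subsetI)
  fix xs assume xs: "xs \<in> dec_lists (Suc r)"
  \<comment> \<open>No entry exceeds the sum, so every list lies in some box of positive height and
    \<open>box_lists_Suc\<close> applies to it.\<close>
  then have "xs \<in> box_lists (Suc r) (Suc (sum_list xs))"
    by (auto simp: box_lists_def intro: le_SucI member_le_sum_list)
  then show "xs \<in> ?A \<union> ?B"
    unfolding box_lists_Suc by (auto simp: box_lists_def)
qed (auto simp: dec_lists_def sorted_wrt_append sorted_wrt_map)

lemma box_lists_degenerate: "box_lists 0 t = {[]}" "box_lists r 0 = {replicate r 0}"
proof -
  show "box_lists r 0 = {replicate r 0}"
    by (auto simp: box_lists_def dec_lists_def sorted_wrt_iff_nth_less intro!: replicate_eqI)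
qed (auto simp: box_lists_def dec_lists_def)

text \<open>The generating function is the Gaussian binomial coefficient in \<open>q^s\<close>. It
  is stated without division, and follows from the q-Pascal rule by induction on
  \<open>r + t\<close>.\<close>

lemma gf_box_lists:
  assumes "0 < s"
  shows "qfact s r * qfact s t * gf (\<lambda>xs. s * sum_list xs) (box_lists r t) = qfact s (r + t)"
proof (induction "r + t" arbitrary: r t)
  case 0
  then show ?case by (simp add: box_lists_degenerate gf_singleton)
next
  case (Suc N)
  show ?case
  proof (cases "r = 0 \<or> t = 0")
    case True
    then show ?thesis by (auto simp: box_lists_degenerate gf_singleton sum_list_replicate)
  next
    case False
    then obtain r' t' where rt: "r = Suc r'" "t = Suc t'" by (meson not0_implies_Suc)
    let ?g = "\<lambda>r t. gf (\<lambda>xs. s * sum_list xs) (box_lists r t)"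
    have IH1: "qfact s r' * qfact s t * ?g r' t = qfact s (r' + t)"
      using Suc rt by simp
    have IH2: "qfact s r * qfact s t' * ?g r t' = qfact s (r' + t)"
      using Suc.hyps(1)[of r t'] Suc.hyps(2) rt by simp
    have "qfact s r * qfact s t * ?g r t = qfact s r * qfact s t * ?g r' t +
        qfact s r * qfact s t * (fps_X ^ (s * Suc r') * ?g r t')"
      using gf_snoc_zero_Un_map_Suc[OF assms _ box_lists_Suc, of r' t' r']
      by (simp add: rt distrib_left box_lists_def)
    also have "qfact s r * qfact s t * ?g r' t =
        (1 - fps_X ^ (s * Suc r')) * (qfact s r' * qfact s t * ?g r' t)"
      unfolding rt(1) qfact_Suc by (simp only: mult_ac)
    also have "\<dots> = (1 - fps_X ^ (s * Suc r')) * qfact s (r' + t)" by (simp only: IH1)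
    also have "qfact s r * qfact s t * (fps_X ^ (s * Suc r') * ?g r t') =
        fps_X ^ (s * Suc r') * (1 - fps_X ^ (s * Suc t')) * (qfact s r * qfact s t' * ?g r t')"
      unfolding rt(2) qfact_Suc by (simp only: mult_ac)
    also have "\<dots> = fps_X ^ (s * Suc r') * (1 - fps_X ^ (s * Suc t')) * qfact s (r' + t)"
      by (simp only: IH2)
    \<comment> \<open>The two contributions combine by
      \<open>(1 - x) + x * (1 - y) = 1 - x * y\<close>.\<close>
    also have "(1 - fps_X ^ (s * Suc r')) * qfact s (r' + t) + \<dots> =
        qfact s (r' + t) * (1 - fps_X ^ (s * Suc r' + s * Suc t'))"
      unfolding power_add by (simp only: algebra_simps) simp
    also have "s * Suc r' + s * Suc t' = s * Suc (r' + t)"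
      by (simp add: rt algebra_simps)
    also have "qfact s (r' + t) * (1 - fps_X ^ (s * Suc (r' + t))) = qfact s (r + t)"
      by (simp add: rt qfact_Suc)
    finally show ?thesis .
  qed
qed

text \<open>Without an upper bound the positive lists lead back to the same set, so the recursion is
  a linear equation for the generating function at \<open>Suc r\<close>; solving it contributes one
  new factor.\<close>

lemma gf_dec_lists:
  assumes "0 < s"
  shows "qfact s r * gf (\<lambda>xs. s * sum_list xs) (dec_lists r) = 1"
proof (induction r)
  case 0
  have "dec_lists 0 = {[]}" by (auto simp: dec_lists_def)
  then show ?case by (simp add: gf_singleton)
next
  case (Suc r)
  let ?g = "\<lambda>r. gf (\<lambda>xs. s * sum_list xs) (dec_lists r)"
  have "(1 - fps_X ^ (s * Suc r)) * ?g (Suc r) = ?g r"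
    using gf_snoc_zero_Un_map_Suc[OF assms order.refl dec_lists_Suc, of r]
    by (simp only: algebra_simps) simp
  then show ?case using Suc by (simp only: qfact_Suc mult.assoc)
qed

text \<open>A list with parts below \<open>2 * Suc c\<close> either avoids the largest admissible
  part \<open>2 * c + 1\<close> or starts with it; removing that head stays in the same set. The
  product is \<open>(q; q^2)_c\<close>.\<close>

lemma gf_odd_lists: "(\<Prod>i<c. 1 - fps_X ^ (2 * i + 1)) * gf sum_list (odd_lists c) = 1"
proof (induction c)
  case 0
  have "odd_lists 0 = {[]}"
    by (auto simp: odd_lists_def)
  then show ?case by (simp add: gf_singleton)
next
  case (Suc c)
  let ?B = "(#) (2 * c + 1) ` odd_lists (Suc c)"
  have eq: "odd_lists (Suc c) = odd_lists c \<union> ?B"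
  proof (intro equalityI subsetI)
    fix xs assume xs: "xs \<in> odd_lists (Suc c)"
    show "xs \<in> odd_lists c \<union> ?B"
    proof (cases xs)
      case Nil
      then show ?thesis by (simp add: odd_lists_def)
    next
      case (Cons y ys)
      have "odd y" "y < 2 * Suc c" using xs Cons by (auto simp: odd_lists_def)
      then have "y = 2 * c + 1 \<or> y < 2 * c" by presburger
      then show ?thesis
        using xs Cons by (fastforce simp: odd_lists_def)
    qed
  next
    fix xs assume "xs \<in> odd_lists c \<union> ?B"
    then consider "xs \<in> odd_lists c" | ys where "xs = (2 * c + 1) # ys" "ys \<in> odd_lists (Suc c)"
      by blast
    then show "xs \<in> odd_lists (Suc c)"
    proof cases
      case 1
      then show ?thesis unfolding odd_lists_def by (auto intro: less_trans)
    next
      case 2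
      then have "x \<le> 2 * c + 1" if "x \<in> set ys" for x
        using that unfolding odd_lists_def by fastforce
      then show ?thesis using 2 unfolding odd_lists_def by simp
    qed
  qed
  have "2 * c + 1 \<notin> set xs" if "xs \<in> odd_lists c" for xs
    using that unfolding odd_lists_def by force
  then have "odd_lists c \<inter> ?B = {}" by fastforce
  moreover have "finite {x \<in> odd_lists c \<union> ?B. sum_list x = n}" for n
    using finite_level_odd_lists by (simp only: eq[symmetric])
  ultimately have "gf sum_list (odd_lists c \<union> ?B) = gf sum_list (odd_lists c) + gf sum_list ?B"
    by (rule gf_Un)
  moreover have "gf sum_list ?B = fps_X ^ (2 * c + 1) * gf sum_list (odd_lists (Suc c))"
    by (rule gf_bij[OF inj_on_imp_bij_betw]) (auto simp: inj_on_def)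
  ultimately have "gf sum_list (odd_lists (Suc c)) =
      gf sum_list (odd_lists c) + fps_X ^ (2 * c + 1) * gf sum_list (odd_lists (Suc c))"
    by (simp only: eq[symmetric])
  then have "(1 - fps_X ^ (2 * c + 1)) * gf sum_list (odd_lists (Suc c)) = gf sum_list (odd_lists c)"
    by (simp only: left_diff_distrib mult_1_left diff_eq_eq)
  then show ?case using Suc by (simp only: prod.lessThan_Suc mult.assoc)
qed

section \<open>Adding a staircase\<close>

text \<open>Adds \<open>c, c + 1, ...\<close> counted from the last entry, turning weakly into
  strictly decreasing lists. With \<open>c = 1\<close> the results are positive, as parts must be;
  \<open>c = 0\<close> is used where zeros are allowed.\<close>

fun stair :: "nat \<Rightarrow> nat list \<Rightarrow> nat list" where
  "stair c [] = []"
| "stair c (y # ys) = (y + c + length ys) # stair c ys"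

definition strict_lists :: "nat \<Rightarrow> nat \<Rightarrow> nat list set" where
  "strict_lists c r = {xs. sorted_wrt (>) xs \<and> (\<forall>x\<in>set xs. c \<le> x) \<and> length xs = r}"

lemma length_stair [simp]: "length (stair c ys) = length ys"
  by (induction ys) auto

lemma sum_list_stair: "sum_list (stair c ys) = sum_list ys + (\<Sum>i<length ys. c + i)"
  by (induction ys) auto

lemma stair_less: "\<forall>y\<in>set ys. y \<le> b \<Longrightarrow> x \<in> set (stair c ys) \<Longrightarrow> x < b + c + length ys"
  by (induction ys) (auto simp: less_Suc_eq)

lemma stair_in_strict_lists: "ys \<in> dec_lists r \<Longrightarrow> stair c ys \<in> strict_lists c r"
proof (induction ys arbitrary: r)
  case (Cons y ys)
  then have "stair c ys \<in> strict_lists c (length ys)" "\<forall>z\<in>set ys. z \<le> y"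
    by (auto simp: dec_lists_def)
  then show ?case
    using Cons.prems stair_less[of ys y] by (auto simp: strict_lists_def dec_lists_def)
qed (simp add: strict_lists_def dec_lists_def)

lemma stair_surj:
  "sorted_wrt (>) xs \<Longrightarrow> \<forall>x\<in>set xs. c \<le> x \<Longrightarrow> \<exists>ys. sorted_wrt (\<ge>) ys \<and> stair c ys = xs"
proof (induction xs)
  case Nil
  then show ?case by (auto intro: exI[of _ "[]"])
next
  case (Cons x xs)
  then obtain ys where ys: "sorted_wrt (\<ge>) ys" "stair c ys = xs" by auto
  have "\<exists>y. x = y + c + length ys \<and> (\<forall>z\<in>set ys. z \<le> y)"
  proof (cases ys)
    case Nil
    then show ?thesis using Cons.prems by (auto intro: exI[of _ "x - c"])
  next
    case (Cons z zs)
    \<comment> \<open>The left side is the head of \<open>stair c ys\<close>. Strictness gives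
      \<open>z \<le> x - c - length ys\<close> with no truncation, so this difference can serve as
      the new head.\<close>
    then have "z + c + length zs < x" using ys Cons.prems by auto
    then show ?thesis using Cons ys(1)
      by (intro exI[of _ "x - c - length ys"]) fastforce
  qed
  then obtain y where "x = y + c + length ys" "\<forall>z\<in>set ys. z \<le> y" by blast
  then show ?case using ys by (intro exI[of _ "y # ys"]) auto
qed

lemma stair_inj: "stair c xs = stair c ys \<Longrightarrow> xs = ys"
proof (induction xs arbitrary: ys)
  case Nil
  then show ?case by (cases ys) auto
next
  case (Cons x xs)
  then obtain y ys' where ys: "ys = y # ys'" by (cases ys) auto
  with Cons.prems have "length xs = length ys'" by (metis length_stair list.inject stair.simps(2))
  then show ?case using Cons ys by auto
qed

lemma bij_betw_stair: "bij_betw (stair c) (dec_lists r) (strict_lists c r)"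
  unfolding bij_betw_def
proof
  show "inj_on (stair c) (dec_lists r)" by (auto simp: inj_on_def dest: stair_inj)
  show "stair c ` dec_lists r = strict_lists c r"
  proof (intro equalityI subsetI)
    fix xs assume "xs \<in> strict_lists c r"
    then obtain ys where "sorted_wrt (\<ge>) ys" "stair c ys = xs" "length xs = r"
      using stair_surj[of xs c] by (auto simp: strict_lists_def)
    then show "xs \<in> stair c ` dec_lists r" by (auto simp: dec_lists_def)
  qed (auto intro: stair_in_strict_lists)
qed

lemma sorted_wrt_greater_iff:
  "sorted_wrt (>) (xs :: nat list) \<longleftrightarrow> sorted_wrt (\<ge>) xs \<and> distinct xs"
  by (induction xs) (auto simp: order.strict_iff_order)

section \<open>Sequences as fibres of the gap count\<close>

text \<open>Two members of \<open>S\<close> belong to the same run exactly when equally many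
  non-members lie below them, so the maximal runs are the fibres of this function on
  \<open>S\<close>.\<close>

definition gaps :: "nat set \<Rightarrow> nat \<Rightarrow> nat" where
  "gaps S x = card ({..<x} - S)"

lemma gaps_mono: "x \<le> y \<Longrightarrow> gaps S x \<le> gaps S y"
  unfolding gaps_def by (rule card_mono) auto

text \<open>The sets of gaps below \<open>x\<close> and below \<open>y\<close> are nested, so equal
  cardinality makes them equal and leaves no gap in \<open>{x..<y}\<close>.\<close>

lemma gaps_eq_iff:
  assumes "x \<le> y" and "y \<in> S"
  shows "gaps S x = gaps S y \<longleftrightarrow> {x..y} \<subseteq> S"
proof
  assume "gaps S x = gaps S y"
  then have "{..<x} - S = {..<y} - S"
    unfolding gaps_def using assms by (intro card_subset_eq) auto
  then have "z \<in> S" if "x \<le> z" "z < y" for z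
    using that by (metis DiffD1 DiffI lessThan_iff not_le)
  then show "{x..y} \<subseteq> S"
    using assms(2) by (auto simp: le_less)
next
  assume sub: "{x..y} \<subseteq> S"
  have "z < x" if "z < y" "z \<notin> S" for z
  proof (rule ccontr)
    assume "\<not> z < x"
    then have "z \<in> {x..y}" using that by simp
    then show False using sub that by blast
  qed
  then have "{..<x} - S = {..<y} - S" using assms(1) by fastforce
  then show "gaps S x = gaps S y" by (simp add: gaps_def)
qed

definition gap_class :: "nat set \<Rightarrow> nat \<Rightarrow> nat set" where
  "gap_class S v = {x \<in> S. gaps S x = v}"

text \<open>Between the least and greatest element of a class there is no gap, and monotonicity of
  \<open>gaps\<close> squeezes everything between them into the class.\<close>

lemma consecutive_run_gap_class:
  assumes "finite S" and "x \<in> S"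
  shows "consecutive_run (gap_class S (gaps S x))"
proof -
  let ?I = "gap_class S (gaps S x)"
  have fin: "finite ?I" "?I \<noteq> {}" using assms by (auto simp: gap_class_def)
  define a b where "a = Min ?I" and "b = Max ?I"
  have ab: "a \<in> ?I" "b \<in> ?I" "a \<le> b"
    using fin by (auto simp: a_def b_def)
  then have sub: "{a..b} \<subseteq> S" using gaps_eq_iff[of a b S] by (auto simp: gap_class_def)
  have "?I = {a..b}"
  proof
    show "?I \<subseteq> {a..b}" using fin by (auto simp: a_def b_def)
    show "{a..b} \<subseteq> ?I"
      using sub ab gaps_mono[of a _ S] gaps_mono[of _ b S]
      by (fastforce simp: gap_class_def)
  qed
  then show ?thesis using ab unfolding consecutive_run_def by blast
qed

lemma run_subset_gap_class:
  assumes "consecutive_run J" and "J \<subseteq> S" and "x \<in> J"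
  shows "J \<subseteq> gap_class S (gaps S x)"
proof
  fix y assume "y \<in> J"
  obtain a b where J: "J = {a..b}" using assms(1) by (auto simp: consecutive_run_def)
  have "{min x y..max x y} \<subseteq> J" using J assms(3) \<open>y \<in> J\<close> by auto
  then have "gaps S (min x y) = gaps S (max x y)"
    using assms(2,3) \<open>y \<in> J\<close> by (subst gaps_eq_iff) (auto simp: max_def)
  then have "gaps S x = gaps S y" by (simp add: min_def max_def split: if_splits)
  then show "y \<in> gap_class S (gaps S x)" using \<open>y \<in> J\<close> assms(2) by (auto simp: gap_class_def)
qed

text \<open>Each gap class is a run and contains every run through any of its elements; hence the
  classes are precisely the maximal runs.\<close>

lemma part_sequences_eq: "part_sequences xs = gap_class (set xs) ` gaps (set xs) ` set xs"
proof (intro equalityI subsetI)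
  fix I assume "I \<in> part_sequences xs"
  then have I: "consecutive_run I" "I \<subseteq> set xs"
    and max: "\<And>J. consecutive_run J \<Longrightarrow> I \<subseteq> J \<Longrightarrow> J \<subseteq> set xs \<Longrightarrow> J = I"
    by (auto simp: part_sequences_def)
  obtain x where x: "x \<in> I" using I(1) unfolding consecutive_run_def by fastforce
  have "gap_class (set xs) (gaps (set xs) x) = I"
    using I x run_subset_gap_class[OF I x] consecutive_run_gap_class[of "set xs" x]
    by (intro max) (auto simp: gap_class_def)
  then show "I \<in> gap_class (set xs) ` gaps (set xs) ` set xs" using I x by blast
next
  fix I assume "I \<in> gap_class (set xs) ` gaps (set xs) ` set xs"
  then obtain x where x: "x \<in> set xs" "I = gap_class (set xs) (gaps (set xs) x)" by auto
  then have "x \<in> I" by (simp add: gap_class_def)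
  then show "I \<in> part_sequences xs"
    using x consecutive_run_gap_class[of "set xs" x] run_subset_gap_class[of _ "set xs" x]
    unfolding part_sequences_def by (auto simp: gap_class_def)
qed

text \<open>Below the new head \<open>y + c + length ys\<close> lie exactly the
  \<open>length ys\<close> later entries, which leaves \<open>y + c\<close> gaps. Inserting this
  larger head does not change the gap counts of the smaller entries.\<close>

lemma map_gaps_stair:
  "sorted_wrt (\<ge>) ys \<Longrightarrow> map (gaps (set (stair c ys))) (stair c ys) = map (\<lambda>y. y + c) ys"
proof (induction ys)
  case (Cons y ys)
  define x where "x = y + c + length ys"
  define S where "S = set (stair c ys)"
  have less: "z < x" if "z \<in> S" for z
    using that stair_less[of ys y z c] Cons.prems by (auto simp: x_def S_def)
  have "distinct (stair c ys)"
    using stair_in_strict_lists[of ys "length ys" c] Cons.prems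
    by (auto simp: strict_lists_def dec_lists_def sorted_wrt_greater_iff)
  then have "card S = length ys" by (simp add: S_def distinct_card)
  moreover have "{..<x} - insert x S = {..<x} - S" by auto
  moreover have "card ({..<x} - S) = x - card S"
    using less by (subst card_Diff_subset) (auto simp: S_def)
  ultimately have x: "gaps (insert x S) x = y + c" by (simp add: gaps_def x_def)
  have "gaps (insert x S) z = gaps S z" if "z \<in> S" for z
    using less[OF that] by (auto simp: gaps_def intro!: arg_cong[where f = card])
  then have "map (gaps (insert x S)) (stair c ys) = map (gaps S) (stair c ys)"
    by (simp add: S_def)
  also have "\<dots> = map (\<lambda>y. y + c) ys" using Cons by (simp add: S_def)
  finally show ?case using x by (simp flip: x_def S_def del: map_eq_conv)
qed simp

text \<open>Multiplicity 0 is even, so only actual entries qualify; the value 0 counts like any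
  other, since it too becomes a sequence after adding the staircase.\<close>

definition odd_values :: "nat list \<Rightarrow> nat set" where
  "odd_values ys = {v. odd (count (mset ys) v)}"

lemma finite_odd_values: "finite (odd_values ys)"
  by (rule finite_subset[of _ "set ys"])
    (auto simp: odd_values_def, metis count_mset_0_iff even_zero)

text \<open>By \<open>map_gaps_stair\<close> the entries equal to \<open>v\<close> become the
  sequence with gap count \<open>v + c\<close>, so the length of a sequence is the multiplicity of
  the value it comes from.\<close>

lemma card_odd_sequences_stair:
  assumes "ys \<in> dec_lists r"
  shows "card {I \<in> part_sequences (stair c ys). odd (card I)} = card (odd_values ys)"
proof -
  define xs where "xs = stair c ys"
  let ?S = "set xs"
  have map: "map (gaps ?S) xs = map (\<lambda>y. y + c) ys"
    using assms map_gaps_stair by (simp add: xs_def dec_lists_def)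
  have dist: "distinct xs"
    using stair_in_strict_lists[OF assms] by (auto simp: xs_def strict_lists_def sorted_wrt_greater_iff)
  have "card (gap_class ?S v) = count (mset (map (gaps ?S) xs)) v" for v
  proof -
    have "count (mset (map (gaps ?S) xs)) v = length (filter (\<lambda>x. gaps ?S x = v) xs)"
      unfolding count_mset count_list_eq_length_filter
      by (simp add: filter_map o_def eq_commute)
    also have "\<dots> = card (gap_class ?S v)"
      using dist by (simp add: gap_class_def flip: distinct_card)
    finally show ?thesis by simp
  qed
  then have card: "card (gap_class ?S (v + c)) = count (mset ys) v" for v
    unfolding map count_mset count_list_eq_length_filter by (simp add: filter_map o_def)
  have img: "gaps ?S ` ?S = (\<lambda>y. y + c) ` set ys"
    using arg_cong[OF map, of set] by simp
  have mem: "v \<in> set ys" if "v \<in> odd_values ys" for v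
    using that by (auto simp: odd_values_def) (metis count_mset_0_iff even_zero)
  have eq: "{I \<in> part_sequences xs. odd (card I)} = (\<lambda>v. gap_class ?S (v + c)) ` odd_values ys"
    unfolding part_sequences_eq img using mem by (auto simp: odd_values_def card image_iff)
  moreover have "inj_on (\<lambda>v. gap_class ?S (v + c)) (odd_values ys)"
  proof (rule inj_onI)
    fix v w assume "v \<in> odd_values ys" and eq: "gap_class ?S (v + c) = gap_class ?S (w + c)"
    then have "v + c \<in> gaps ?S ` ?S" using mem img by blast
    then obtain x where "x \<in> gap_class ?S (v + c)" by (auto simp: gap_class_def)
    then show "v = w" using eq by (auto simp: gap_class_def)
  qed
  ultimately show ?thesis by (simp add: card_image xs_def)
qed

section \<open>Lists with a prescribed number of values of odd multiplicity\<close>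

definition odd_mult_lists :: "nat \<Rightarrow> nat \<Rightarrow> nat list set" where
  "odd_mult_lists K r = {ys \<in> dec_lists K. card (odd_values ys) = r}"

text \<open>\<open>N\<close> takes half of each multiplicity, rounded down; the remainder modulo 2
  is the indicator of \<open>odd_values ys\<close>.\<close>

lemma mset_odd_values_decomp: "\<exists>N. mset ys = mset_set (odd_values ys) + N + N"
proof -
  define N where "N = Abs_multiset (\<lambda>v. count (mset ys) v div 2)"
  have "finite {v. 0 < count (mset ys) v div 2}"
    by (rule finite_subset[of _ "set_mset (mset ys)"]) (auto, metis count_mset_0_iff div_0 less_numeral_extra(3))
  then have N: "count N v = count (mset ys) v div 2" for v
    unfolding N_def by (subst count_Abs_multiset) auto
  have "count (mset_set (odd_values ys)) v = count (mset ys) v mod 2" for v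
    using finite_odd_values[of ys] by (simp add: count_mset_set' odd_values_def odd_iff_mod_2_eq_one)
  then have "mset ys = mset_set (odd_values ys) + N + N"
    by (intro multiset_eqI) (simp add: N, presburger)
  then show ?thesis by blast
qed

lemma sorted_wrt_ge_iff_sorted_rev: "sorted_wrt (\<ge>) (xs :: nat list) \<longleftrightarrow> sorted (rev xs)"
  by (simp add: sorted_wrt_rev)

lemma dec_mset_unique:
  assumes "sorted_wrt (\<ge>) (xs :: nat list)" and "sorted_wrt (\<ge>) ys" and "mset xs = mset ys"
  shows "xs = ys"
proof -
  have "sort (rev ys) = rev xs"
    by (rule properties_for_sort) (use assms in \<open>simp_all add: sorted_wrt_ge_iff_sorted_rev\<close>)
  moreover have "sort (rev ys) = rev ys"
    using assms(2) by (simp add: sorted_wrt_ge_iff_sorted_rev sorted_sort_id)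
  ultimately show ?thesis by simp
qed

text \<open>Comparing sizes in the decomposition fixes the number of pairs; it also forces
  \<open>r \<le> K\<close>, from which the vanishing in \<open>D_eq_0\<close> follows.\<close>

lemma odd_mult_listsD:
  assumes "ys \<in> odd_mult_lists K r"
  obtains j N where "K = r + 2 * j" "size N = j" "mset ys = mset_set (odd_values ys) + N + N"
proof -
  obtain N where N: "mset ys = mset_set (odd_values ys) + N + N"
    using mset_odd_values_decomp by blast
  have "size (mset ys) = card (odd_values ys) + size N + size N"
    by (subst N) simp
  then have "K = r + 2 * size N"
    using assms by (auto simp: odd_mult_lists_def dec_lists_def)
  then show ?thesis using N that by blast
qed

text \<open>\<open>stair 0 us\<close> supplies each value of odd multiplicity once, and the doubled
  \<open>vs\<close> supplies the pairs, which may repeat such values without changing a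
  parity.\<close>

definition merge_pairs :: "nat list \<times> nat list \<Rightarrow> nat list" where
  "merge_pairs = (\<lambda>(us, vs). rev (sort (stair 0 us @ vs @ vs)))"

lemma mset_merge_pairs: "mset (merge_pairs (us, vs)) = mset (stair 0 us) + mset vs + mset vs"
  by (simp add: merge_pairs_def)

lemma odd_values_merge_pairs:
  assumes "us \<in> dec_lists r"
  shows "odd_values (merge_pairs (us, vs)) = set (stair 0 us)"
proof -
  have "distinct (stair 0 us)"
    using stair_in_strict_lists[OF assms] by (auto simp: strict_lists_def sorted_wrt_greater_iff)
  then have "count (mset (stair 0 us)) v = (if v \<in> set (stair 0 us) then 1 else 0)" for v
    by (simp add: distinct_count_atmost_1)
  then show ?thesis unfolding odd_values_def mset_merge_pairs by auto
qed

text \<open>The odd values of the merged list recover \<open>stair 0 us\<close> and hence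
  \<open>us\<close>; halving the remaining multiplicities recovers \<open>vs\<close>.\<close>

lemma bij_betw_merge_pairs:
  "bij_betw merge_pairs (dec_lists r \<times> dec_lists j) (odd_mult_lists (r + 2 * j) r)"
  unfolding bij_betw_def
proof
  show "inj_on merge_pairs (dec_lists r \<times> dec_lists j)"
  proof (rule inj_onI, clarify)
    fix us vs us' vs'
    assume us: "us \<in> dec_lists r" "us' \<in> dec_lists r" and vs: "vs \<in> dec_lists j" "vs' \<in> dec_lists j"
      and eq: "merge_pairs (us, vs) = merge_pairs (us', vs')"
    have str: "stair 0 us \<in> strict_lists 0 r" "stair 0 us' \<in> strict_lists 0 r"
      using us by (auto intro: stair_in_strict_lists)
    have "set (stair 0 us) = set (stair 0 us')"
      using odd_values_merge_pairs us eq by metis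
    then have "mset (stair 0 us) = mset (stair 0 us')"
      using str by (metis (mono_tags, lifting) mem_Collect_eq mset_set_set
          sorted_wrt_greater_iff strict_lists_def)
    moreover from this have "mset vs + mset vs = mset vs' + mset vs'"
      using arg_cong[OF eq, of mset] by (simp add: mset_merge_pairs)
    then have "mset vs = mset vs'"
      by (auto simp: multiset_eq_iff) (metis add_self_div_2)
    ultimately have "stair 0 us = stair 0 us'" "vs = vs'"
      using str vs
      by (auto intro!: dec_mset_unique simp: strict_lists_def dec_lists_def sorted_wrt_greater_iff)
    then show "us = us' \<and> vs = vs'" by (auto dest: stair_inj)
  qed
  show "merge_pairs ` (dec_lists r \<times> dec_lists j) = odd_mult_lists (r + 2 * j) r"
  proof (intro equalityI subsetI)
    fix ys assume "ys \<in> merge_pairs ` (dec_lists r \<times> dec_lists j)"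
    then obtain us vs where uv: "us \<in> dec_lists r" "vs \<in> dec_lists j" "ys = merge_pairs (us, vs)"
      by auto
    have "card (odd_values ys) = r"
      using odd_values_merge_pairs[OF uv(1)] stair_in_strict_lists[OF uv(1), of 0] uv(3)
      by (auto simp: strict_lists_def sorted_wrt_greater_iff distinct_card)
    moreover have "ys \<in> dec_lists (r + 2 * j)"
      using uv by (auto simp: merge_pairs_def dec_lists_def sorted_wrt_rev)
    ultimately show "ys \<in> odd_mult_lists (r + 2 * j) r" by (simp add: odd_mult_lists_def)
  next
    fix ys assume ys: "ys \<in> odd_mult_lists (r + 2 * j) r"
    then obtain N where N: "size N = j" "mset ys = mset_set (odd_values ys) + N + N"
      by (elim odd_mult_listsD) auto
    define vs where "vs = rev (sorted_list_of_multiset N)"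
    have vs: "vs \<in> dec_lists j" "mset vs = N"
      using N(1) by (auto simp: vs_def dec_lists_def sorted_wrt_rev simp flip: size_mset)
    have "rev (sorted_list_of_set (odd_values ys)) \<in> strict_lists 0 r"
      using ys by (auto simp: strict_lists_def odd_mult_lists_def sorted_wrt_rev)
    then obtain us where us: "us \<in> dec_lists r" "stair 0 us = rev (sorted_list_of_set (odd_values ys))"
      using bij_betw_stair[of 0 r] by (auto simp: bij_betw_def) (metis imageE)
    have "mset (sorted_list_of_set (odd_values ys)) = mset_set (odd_values ys)"
      using mset_set_set[of "sorted_list_of_set (odd_values ys)"] finite_odd_values[of ys] by simp
    then have "mset (merge_pairs (us, vs)) = mset ys"
      using N(2) by (simp add: mset_merge_pairs us vs)
    then have "merge_pairs (us, vs) = ys"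
      using ys by (intro dec_mset_unique)
        (auto simp: merge_pairs_def odd_mult_lists_def dec_lists_def sorted_wrt_rev)
    then show "ys \<in> merge_pairs ` (dec_lists r \<times> dec_lists j)" using us(1) vs(1) by force
  qed
qed

text \<open>The power of \<open>fps_X\<close> is the weight of the staircase in
  \<open>stair 0\<close>. The factor \<open>1 *\<close> keeps the shape
  \<open>s * sum_list xs\<close> of \<open>gf_dec_lists\<close>.\<close>

lemma gf_odd_mult_lists:
  "gf sum_list (odd_mult_lists (r + 2 * j) r) = fps_X ^ (\<Sum>i<r. i) *
    (gf (\<lambda>xs. 1 * sum_list xs) (dec_lists r) * gf (\<lambda>xs. 2 * sum_list xs) (dec_lists j))"
proof -
  have "gf sum_list (odd_mult_lists (r + 2 * j) r) = fps_X ^ (\<Sum>i<r. i) *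
      gf (\<lambda>(us, vs). 1 * sum_list us + 2 * sum_list vs) (dec_lists r \<times> dec_lists j)"
  proof (rule gf_bij[OF bij_betw_merge_pairs])
    fix p assume p: "p \<in> dec_lists r \<times> dec_lists j"
    obtain us vs where [simp]: "p = (us, vs)" by (cases p)
    have "sum_list (merge_pairs p) = sum_mset (mset (merge_pairs p))"
      by (simp only: sum_mset_sum_list)
    also have "\<dots> = sum_list (stair 0 us) + 2 * sum_list vs"
      by (simp add: mset_merge_pairs sum_mset_sum_list)
    finally show "sum_list (merge_pairs p) =
        (case p of (us, vs) \<Rightarrow> 1 * sum_list us + 2 * sum_list vs) + (\<Sum>i<r. i)"
      using p by (simp add: sum_list_stair dec_lists_def)
  qed
  then show ?thesis
    by (subst (asm) gf_Times) (use finite_level_dec_lists[of 1] finite_level_dec_lists[of 2] in auto)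
qed

text \<open>Removing the staircase \<open>1, 2, ..., K\<close> from the distinct parts turns a count
  of odd sequences into a count of values of odd multiplicity.\<close>

lemma D_eq_coeff: "int (D n K r) = fps_nth (fps_X ^ (\<Sum>i<K. 1 + i) * gf sum_list (odd_mult_lists K r)) n"
proof -
  let ?T = "{xs \<in> strict_lists 1 K. card {I \<in> part_sequences xs. odd (card I)} = r}"
  have "bij_betw (stair 1) (odd_mult_lists K r) ?T"
    unfolding bij_betw_def
  proof
    show "inj_on (stair 1) (odd_mult_lists K r)" by (auto simp: inj_on_def dest: stair_inj)
    have "strict_lists 1 K = stair 1 ` dec_lists K"
      using bij_betw_stair[of 1 K] by (simp add: bij_betw_def)
    then show "stair 1 ` odd_mult_lists K r = ?T"
      by (auto simp: odd_mult_lists_def card_odd_sequences_stair)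
  qed
  then have gf: "gf sum_list ?T = fps_X ^ (\<Sum>i<K. 1 + i) * gf sum_list (odd_mult_lists K r)"
    by (rule gf_bij) (auto simp: sum_list_stair odd_mult_lists_def dec_lists_def)
  have "{xs \<in> distinct_partitions_of n. length xs = K \<and>
      card {I \<in> part_sequences xs. odd (card I)} = r} = {xs \<in> ?T. sum_list xs = n}"
    by (auto simp: distinct_partitions_of_def partitions_of_def strict_lists_def
        sorted_wrt_greater_iff Suc_le_eq)
  then show ?thesis unfolding D_def gf[symmetric] gf_nth by (rule arg_cong)
qed

section \<open>Durfee dissection of a partition into odd parts\<close>

lemma part_append:
  "part (xs @ ys) i = (if i \<le> length xs then part xs i else part ys (i - length xs))"
  by (auto simp: part_def nth_append)

lemma part_in_set: "1 \<le> i \<Longrightarrow> i \<le> length xs \<Longrightarrow> part xs i \<in> set xs"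
  by (simp add: part_def)

lemma part_pos_in_set: "0 < part xs i \<Longrightarrow> part xs i \<in> set xs \<and> 1 \<le> i \<and> i \<le> length xs"
  by (auto simp: part_def split: if_splits)

lemma part_less: "\<forall>x\<in>set xs. x < b \<Longrightarrow> 0 < b \<Longrightarrow> part xs i < b"
  by (auto simp: part_def)

lemma part_antimono:
  assumes "sorted_wrt (\<ge>) xs" and "1 \<le> i" and "i \<le> j"
  shows "part xs j \<le> part xs i"
proof (cases "i < j \<and> j \<le> length xs")
  case True
  then show ?thesis
    using assms sorted_wrt_nth_less[OF assms(1), of "i - 1" "j - 1"] by (auto simp: part_def)
next
  case False
  then have "i = j \<or> length xs < j" using assms(3) by linarith
  then show ?thesis by (auto simp: part_def)
qed

lemma part_le_take:
  assumes "sorted_wrt (\<ge>) xs" and "x \<in> set (take k xs)"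
  shows "part xs k \<le> x"
proof -
  obtain i where "i < k" "i < length xs" "x = xs ! i"
    using assms(2) by (auto simp: in_set_conv_nth)
  then have "x = part xs (Suc i)" "Suc i \<le> k" by (auto simp: part_def)
  then show ?thesis using part_antimono[OF assms(1), of "Suc i" k] by simp
qed

lemma drop_le_part:
  assumes "sorted_wrt (\<ge>) xs" and "x \<in> set (drop k xs)"
  shows "x \<le> part xs (Suc k)"
proof -
  obtain i where "i < length (drop k xs)" "x = drop k xs ! i"
    using assms(2) by (metis in_set_conv_nth)
  then have "k + i < length xs" "x = xs ! (k + i)" by auto
  then have "x = part xs (Suc (k + i))" by (auto simp: part_def)
  then show ?thesis using part_antimono[OF assms(1), of "Suc k" "Suc (k + i)"] by simp
qed

section \<open>Durfee sides characterized by inequalities on single rows\<close>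

lemma Max_downward_closed:
  fixes P :: "nat \<Rightarrow> bool"
  assumes fin: "finite {i. P i}" and "P 0" and step: "\<And>i. P (Suc i) \<Longrightarrow> P i"
  shows "Max {i. P i} = m \<longleftrightarrow> P m \<and> \<not> P (Suc m)"
proof
  assume "Max {i. P i} = m"
  then show "P m \<and> \<not> P (Suc m)"
    using Max_in[OF fin] Max_ge[OF fin, of "Suc m"] assms(2) by auto
next
  assume m: "P m \<and> \<not> P (Suc m)"
  have down: "P i" if "i \<le> j" "P j" for i j
    using that by (induction rule: inc_induct) (auto intro: step)
  have "i \<le> m" if "P i" for i
    using down[of "Suc m" i] that m by (meson not_less_eq_eq)
  then show "Max {i. P i} = m"
    using fin m by (intro Max_eqI) auto
qed

text \<open>Rows shrink while the bound grows, so the condition is downward closed. \<open>a\<close>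
  counts the rows skipped and \<open>t\<close> is the extra length: \<open>t = 0\<close> describes
  squares, \<open>t = 2\<close> the rectangle of type II, as
  \<open>2 * i - 1 + 2 = 2 * i + 1\<close> for positive \<open>i\<close>.\<close>

lemma Max_part_iff:
  assumes "sorted_wrt (\<ge>) xs"
  shows "Max {i. i = 0 \<or> 2 * i - 1 + t \<le> part xs (a + i)} = m \<longleftrightarrow>
    (m = 0 \<or> 2 * m - 1 + t \<le> part xs (a + m)) \<and> part xs (a + Suc m) < 2 * m + 1 + t"
proof (subst Max_downward_closed)
  have "i \<le> length xs" if "i = 0 \<or> 2 * i - 1 + t \<le> part xs (a + i)" for i
    using that part_pos_in_set[of xs "a + i"] by (cases i) auto
  then show "finite {i. i = 0 \<or> 2 * i - 1 + t \<le> part xs (a + i)}"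
    unfolding finite_nat_set_iff_bounded_le by blast
  show "i = 0 \<or> 2 * i - 1 + t \<le> part xs (a + i)"
    if "Suc i = 0 \<or> 2 * Suc i - 1 + t \<le> part xs (a + Suc i)" for i
    using that part_antimono[OF assms, of "a + i" "a + Suc i"] by (cases "i = 0") auto
qed auto

lemma Dur2_eq_iff:
  assumes "sorted_wrt (\<ge>) xs" and "\<forall>x\<in>set xs. 0 < x" and "1 \<le> k"
  shows "Dur2 xs = k \<longleftrightarrow> 2 * k - 1 \<le> part xs k \<and> part xs (Suc k) < 2 * k + 1"
proof (cases "xs = []")
  case True
  then show ?thesis using assms(3) by (simp add: Dur2_def part_def)
next
  case False
  let ?T = "{i. 1 \<le> i \<and> 2 * i - 1 \<le> part xs i}"
  \<comment> \<open>\<open>Dur2\<close> takes its maximum over positive indices only. Adding 0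
    reaches the common form and does not alter the maximum, since a nonempty list of positive parts
    satisfies the condition at 1.\<close>
  have eq: "{i. i = 0 \<or> 2 * i - 1 + 0 \<le> part xs (0 + i)} = insert 0 ?T" by auto
  have "i \<le> length xs" if "i \<in> ?T" for i
    using that part_pos_in_set[of xs i] by auto
  then have fin: "finite ?T" unfolding finite_nat_set_iff_bounded_le by blast
  have "part xs 1 \<in> set xs" using False by (intro part_in_set) (auto simp: Suc_le_eq)
  then have "1 \<in> ?T" using assms(2) by (auto simp: Suc_le_eq)
  then have "Max (insert 0 ?T) = Max ?T" using fin by (subst Max_insert) auto
  then show ?thesis
    using Max_part_iff[OF assms(1), of 0 0 k, unfolded eq] False assms(3) by (simp add: Dur2_def)
qed

lemma type_I_iff:
  assumes "sorted_wrt (\<ge>) xs" and odd: "\<forall>x\<in>set xs. odd x" and "1 \<le> k"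
  shows "Dur2 xs = k \<and> type_I xs \<and> sub_dur2 xs = m \<longleftrightarrow>
    2 * k + 1 \<le> part xs k \<and> part xs (Suc k) < 2 * k + 1 \<and>
    (m = 0 \<or> 2 * m - 1 \<le> part xs (k + m)) \<and> part xs (k + Suc m) < 2 * m + 1"
proof -
  have pos: "\<forall>x\<in>set xs. 0 < x" using odd odd_pos by blast
  \<comment> \<open>By parity, a row longer than \<open>2 * k - 1\<close> has length at least
    \<open>2 * k + 1\<close>.\<close>
  have gt: "2 * k - 1 < part xs k \<longleftrightarrow> 2 * k + 1 \<le> part xs k"
  proof
    assume less: "2 * k - 1 < part xs k"
    then have "odd (part xs k)" using odd part_pos_in_set[of xs k] by auto
    moreover have "2 * k \<le> part xs k" using less by linarith
    ultimately show "2 * k + 1 \<le> part xs k" by (cases "part xs k = 2 * k") auto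
  qed (use assms(3) in auto)
  have "Dur2 xs = k \<and> type_I xs \<and> sub_dur2 xs = m \<longleftrightarrow>
      Dur2 xs = k \<and> 2 * k + 1 \<le> part xs k \<and>
      Max {i. i = 0 \<or> 2 * i - 1 + 0 \<le> part xs (k + i)} = m"
    using assms(3) gt by (auto simp: type_I_def sub_dur2_def)
  then show ?thesis
    unfolding Max_part_iff[OF assms(1)] Dur2_eq_iff[OF assms(1) pos assms(3)] by auto
qed

lemma type_II_iff:
  assumes "sorted_wrt (\<ge>) xs" and odd: "\<forall>x\<in>set xs. odd x" and "1 \<le> k"
  shows "Dur2 xs = k \<and> type_II xs \<and> sub_dur2 xs = m \<longleftrightarrow>
    part xs k = 2 * k - 1 \<and> (m = 0 \<or> 2 * m + 1 \<le> part xs (k + m)) \<and>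
    part xs (k + Suc m) < 2 * m + 3"
proof -
  have pos: "\<forall>x\<in>set xs. 0 < x" using odd odd_pos by blast
  have eq: "{j. j = 0 \<or> 2 * j + 1 \<le> part xs (k + j)} =
      {i. i = 0 \<or> 2 * i - 1 + 2 \<le> part xs (k + i)}"
    by auto
  define M where "M = Max {i. i = 0 \<or> 2 * i - 1 + 2 \<le> part xs (k + i)}"
  have M: "M = m \<longleftrightarrow> (m = 0 \<or> 2 * m + 1 \<le> part xs (k + m)) \<and> part xs (k + Suc m) < 2 * m + 3"
    unfolding M_def Max_part_iff[OF assms(1)] by (cases m) auto
  have "sub_dur2 xs = M" if "Dur2 xs = k" "part xs k = 2 * k - 1"
    unfolding M_def eq[symmetric]
    using that assms(3) by (simp add: type_I_def type_II_def sub_dur2_def)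
  moreover have "Dur2 xs = k \<and> type_II xs \<longleftrightarrow> Dur2 xs = k \<and> part xs k = 2 * k - 1"
    using assms(3) unfolding type_II_def by blast
  ultimately have "Dur2 xs = k \<and> type_II xs \<and> sub_dur2 xs = m \<longleftrightarrow>
      Dur2 xs = k \<and> part xs k = 2 * k - 1 \<and> M = m"
    by metis
  \<comment> \<open>In type II the bound on row \<open>Suc k\<close> in \<open>Dur2_eq_iff\<close>
    comes from monotonicity, since row \<open>k\<close> already has length
    \<open>2 * k - 1\<close>.\<close>
  moreover have "part xs (Suc k) < 2 * k + 1" if "part xs k = 2 * k - 1"
    using that part_antimono[OF assms(1), of k "Suc k"] assms(3) by linarith
  ultimately show ?thesis
    unfolding M Dur2_eq_iff[OF assms(1) pos assms(3)] by (metis order.refl)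
qed

section \<open>Blocks of odd rows and their gluing\<close>

definition odd_ge_lists :: "nat \<Rightarrow> nat \<Rightarrow> nat list set" where
  "odd_ge_lists r b = {xs \<in> dec_lists r. \<forall>x\<in>set xs. odd x \<and> b \<le> x}"

definition odd_between_lists :: "nat \<Rightarrow> nat \<Rightarrow> nat \<Rightarrow> nat list set" where
  "odd_between_lists r b u = {xs \<in> odd_ge_lists r b. \<forall>x\<in>set xs. x \<le> u}"

lemma halve_odd_ge_list:
  assumes "odd b" and "xs \<in> odd_ge_lists r b"
  obtains ys where "ys \<in> dec_lists r" "xs = map (\<lambda>x. 2 * x + b) ys"
proof
  let ?ys = "map (\<lambda>x. (x - b) div 2) xs"
  have "sorted_wrt (\<lambda>x y. (x - b) div 2 \<ge> (y - b) div 2) xs"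
    using assms(2) by (auto simp: odd_ge_lists_def dec_lists_def
        intro!: sorted_wrt_mono_rel[of xs "(\<ge>)"] div_le_mono diff_le_mono)
  then show "?ys \<in> dec_lists r"
    using assms(2) by (simp add: odd_ge_lists_def dec_lists_def sorted_wrt_map)
  have "2 * ((x - b) div 2) + b = x" if "x \<in> set xs" for x
  proof -
    have "b \<le> x" "even (x - b)" using that assms by (auto simp: odd_ge_lists_def)
    then show ?thesis by simp
  qed
  then show "xs = map (\<lambda>x. 2 * x + b) ?ys" by (simp add: map_idI)
qed

lemma sum_list_double_shift: "sum_list (map (\<lambda>x. 2 * x + b) ys) = 2 * sum_list ys + length ys * b"
  for b :: nat
  by (induction ys) auto

lemma inj_double_shift: "inj_on (map (\<lambda>x. 2 * x + b)) (S :: nat list set)"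
  by (auto simp: inj_on_def intro!: map_injective[of "\<lambda>x. 2 * x + b"] injI)

lemma gf_odd_ge_lists:
  assumes "odd b"
  shows "gf sum_list (odd_ge_lists r b) = fps_X ^ (r * b) * gf (\<lambda>xs. 2 * sum_list xs) (dec_lists r)"
proof (rule gf_bij)
  have "map (\<lambda>x. 2 * x + b) ` dec_lists r = odd_ge_lists r b"
  proof (intro equalityI subsetI)
    fix xs assume "xs \<in> odd_ge_lists r b"
    then show "xs \<in> map (\<lambda>x. 2 * x + b) ` dec_lists r"
      using halve_odd_ge_list[OF assms] by blast
  qed (use assms in \<open>auto simp: odd_ge_lists_def dec_lists_def sorted_wrt_map\<close>)
  then show "bij_betw (map (\<lambda>x. 2 * x + b)) (dec_lists r) (odd_ge_lists r b)"
    by (simp add: bij_betw_def inj_double_shift)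
qed (auto simp: sum_list_double_shift dec_lists_def)

text \<open>Halving after subtracting \<open>b\<close> gives a list in an \<open>r\<close> by
  \<open>t\<close> box. The case \<open>r = 0\<close> stands apart because in the application
  \<open>b = 2 * (r + e) - 1\<close> truncates to the even number 0 when
  \<open>r = e = 0\<close>.\<close>

lemma gf_odd_between_lists:
  assumes "r = 0 \<or> odd b \<and> u = 2 * t + b"
  shows "gf sum_list (odd_between_lists r b u) =
    fps_X ^ (r * b) * gf (\<lambda>xs. 2 * sum_list xs) (box_lists r t)"
proof (cases "r = 0")
  case True
  then have "odd_between_lists r b u = {[]}"
    by (auto simp: odd_between_lists_def odd_ge_lists_def dec_lists_def)
  then show ?thesis using True by (simp add: box_lists_degenerate gf_singleton)
next
  case False
  then have b: "odd b" "u = 2 * t + b" using assms by auto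
  have "map (\<lambda>x. 2 * x + b) ` box_lists r t = odd_between_lists r b u"
  proof (intro equalityI subsetI)
    fix xs assume xs: "xs \<in> odd_between_lists r b u"
    then obtain ys where "ys \<in> dec_lists r" "xs = map (\<lambda>x. 2 * x + b) ys"
      using halve_odd_ge_list[OF b(1)] unfolding odd_between_lists_def by blast
    then show "xs \<in> map (\<lambda>x. 2 * x + b) ` box_lists r t"
      using xs b(2) by (auto simp: box_lists_def odd_between_lists_def)
  qed (use b in \<open>auto simp: odd_between_lists_def odd_ge_lists_def box_lists_def dec_lists_def sorted_wrt_map\<close>)
  then have "bij_betw (map (\<lambda>x. 2 * x + b)) (box_lists r t) (odd_between_lists r b u)"
    by (simp add: bij_betw_def inj_double_shift)
  then show ?thesis
    by (rule gf_bij) (auto simp: sum_list_double_shift box_lists_def dec_lists_def)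
qed

text \<open>The components are \<open>h\<close> rows reaching beyond the Durfee square of side
  \<open>h\<close> (\<open>e = 0\<close>) or covering the first \<open>h\<close> rows of one of side
  \<open>h + 1\<close> (\<open>e = 1\<close>), then the \<open>m\<close> rows through the sub-Durfee
  square or rectangle, then the rows below it.\<close>

definition dissections :: "nat \<Rightarrow> nat \<Rightarrow> nat \<Rightarrow> (nat list \<times> nat list \<times> nat list) set" where
  "dissections e h m = odd_ge_lists h (2 * h + 1) \<times>
     odd_between_lists m (2 * (m + e) - 1) (2 * (h + e) - 1) \<times> odd_lists (m + e)"

text \<open>The middle block is, in type II, the last row of the Durfee square, whose length is forced.\<close>

definition glue :: "nat \<Rightarrow> nat \<Rightarrow> nat list \<times> nat list \<times> nat list \<Rightarrow> nat list" where
  "glue e h = (\<lambda>(as, bs, cs). as @ replicate e (2 * h + 1) @ bs @ cs)"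

lemma glue_dec_odd:
  assumes "p \<in> dissections e h m" and "m \<le> h" and "e \<le> 1"
  shows "sorted_wrt (\<ge>) (glue e h p)" and "\<forall>x\<in>set (glue e h p). odd x"
proof -
  obtain as bs cs where p: "p = (as, bs, cs)" by (cases p)
  have as: "sorted_wrt (\<ge>) as" "\<And>x. x \<in> set as \<Longrightarrow> odd x \<and> 2 * h + 1 \<le> x"
    and bs: "sorted_wrt (\<ge>) bs"
      "\<And>x. x \<in> set bs \<Longrightarrow> odd x \<and> 2 * (m + e) - 1 \<le> x \<and> x \<le> 2 * (h + e) - 1"
    and cs: "sorted_wrt (\<ge>) cs" "\<And>x. x \<in> set cs \<Longrightarrow> odd x \<and> x < 2 * (m + e)"
    using assms(1)
    by (auto simp: p dissections_def odd_ge_lists_def odd_between_lists_def odd_lists_def dec_lists_def)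
  have "x \<ge> y" if "x \<in> set as" "y \<in> set bs \<union> set cs" for x y
    using as(2)[OF that(1)] bs(2)[of y] cs(2)[of y] that(2) assms(2,3) by fastforce
  moreover have "2 * h + 1 \<ge> y" if "y \<in> set bs \<union> set cs" for y
    using bs(2)[of y] cs(2)[of y] that assms(2,3) by fastforce
  moreover have "x \<ge> y" if "x \<in> set bs" "y \<in> set cs" for x y
    using bs(2)[OF that(1)] cs(2)[OF that(2)] by linarith
  ultimately show "sorted_wrt (\<ge>) (glue e h p)"
    using as bs(1) cs(1)
    by (auto simp: glue_def p sorted_wrt_append sorted_wrt_iff_nth_less[of _ "replicate _ _"])
  show "\<forall>x\<in>set (glue e h p). odd x"
    using as bs cs by (auto simp: glue_def p)
qed

lemma inj_glue: "inj_on (glue e h) (dissections e h m)"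
  by (auto simp: inj_on_def glue_def dissections_def odd_ge_lists_def odd_between_lists_def dec_lists_def)

lemma glue_surj:
  assumes "sorted_wrt (\<ge>) xs" and "\<forall>x\<in>set xs. odd x"
    and "h + e + m \<le> length xs"
    and "take e (drop h xs) = replicate e (2 * h + 1)"
    and "\<And>x. x \<in> set (take h xs) \<Longrightarrow> 2 * h + 1 \<le> x"
    and "\<And>x. x \<in> set (take m (drop (h + e) xs)) \<Longrightarrow> 2 * (m + e) - 1 \<le> x \<and> x \<le> 2 * (h + e) - 1"
    and "\<And>x. x \<in> set (drop (h + e + m) xs) \<Longrightarrow> x < 2 * (m + e)"
  shows "xs \<in> glue e h ` dissections e h m"
proof
  let ?p = "(take h xs, take m (drop (h + e) xs), drop (h + e + m) xs)"
  have "xs = take h xs @ take e (drop h xs) @ take m (drop e (drop h xs)) @ drop m (drop e (drop h xs))"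
    by (simp only: append_take_drop_id)
  also have "\<dots> = glue e h ?p"
    unfolding assms(4) by (simp add: glue_def add_ac)
  finally show "xs = glue e h ?p" .
  have "\<forall>x\<in>set (take h xs). odd x" "\<forall>x\<in>set (take m (drop (h + e) xs)). odd x"
    "\<forall>x\<in>set (drop (h + e + m) xs). odd x"
    using assms(2) by (auto dest!: in_set_takeD in_set_dropD)
  then show "?p \<in> dissections e h m"
    using assms(1,3,5,6,7)
    by (auto simp: dissections_def odd_ge_lists_def odd_between_lists_def odd_lists_def dec_lists_def
        sorted_wrt_take sorted_wrt_drop)
qed

section \<open>The two types as glued dissections\<close>

definition type_I_lists :: "nat \<Rightarrow> nat \<Rightarrow> nat list set" where
  "type_I_lists k m = {xs. sorted_wrt (\<ge>) xs \<and> (\<forall>x\<in>set xs. odd x) \<and>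
     Dur2 xs = k \<and> type_I xs \<and> sub_dur2 xs = m}"

definition type_II_lists :: "nat \<Rightarrow> nat \<Rightarrow> nat list set" where
  "type_II_lists k m = {xs. sorted_wrt (\<ge>) xs \<and> (\<forall>x\<in>set xs. odd x) \<and>
     Dur2 xs = k \<and> type_II xs \<and> sub_dur2 xs = m}"

text \<open>For \<open>m > k\<close> row \<open>k + m\<close> would have length at least
  \<open>2 * k + 1\<close>, but it is no longer than row \<open>Suc k\<close>, which is shorter than
  that.\<close>

lemma type_I_lists_sub_le:
  assumes "xs \<in> type_I_lists k m" and "1 \<le> k"
  shows "m \<le> k"
proof (rule ccontr)
  assume "\<not> m \<le> k"
  have dec: "sorted_wrt (\<ge>) xs" using assms(1) by (simp add: type_I_lists_def)
  have "part xs (Suc k) < 2 * k + 1" "2 * m - 1 \<le> part xs (k + m)"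
    using assms \<open>\<not> m \<le> k\<close> type_I_iff[of xs k m] by (auto simp: type_I_lists_def)
  moreover have "part xs (k + m) \<le> part xs (Suc k)"
    using part_antimono[OF dec] \<open>\<not> m \<le> k\<close> assms(2) by simp
  ultimately show False using \<open>\<not> m \<le> k\<close> by linarith
qed

lemma type_II_lists_sub_le:
  assumes "xs \<in> type_II_lists (Suc h) m"
  shows "m \<le> h"
proof (rule ccontr)
  assume "\<not> m \<le> h"
  have dec: "sorted_wrt (\<ge>) xs" using assms(1) by (simp add: type_II_lists_def)
  have "part xs (Suc h) = 2 * h + 1" "2 * m + 1 \<le> part xs (Suc h + m)"
    using assms \<open>\<not> m \<le> h\<close> type_II_iff[of xs "Suc h" m] by (auto simp: type_II_lists_def)
  moreover have "part xs (Suc h + m) \<le> part xs (Suc h)" using part_antimono[OF dec] by simp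
  ultimately have "2 * m + 1 \<le> 2 * h + 1" by (metis order.trans)
  then show False using \<open>\<not> m \<le> h\<close> by simp
qed

text \<open>The four inequalities of \<open>type_I_iff\<close> at rows \<open>k\<close>,
  \<open>k + 1\<close>, \<open>k + m\<close> and \<open>k + m + 1\<close> spread over whole blocks
  by monotonicity; parity sharpens the strict upper bounds to those of the blocks.\<close>

lemma glue_type_I:
  assumes "1 \<le> k" and "m \<le> k"
  shows "glue 0 k ` dissections 0 k m = type_I_lists k m"
proof (intro equalityI subsetI)
  fix xs assume "xs \<in> glue 0 k ` dissections 0 k m"
  then obtain as bs cs where p: "(as, bs, cs) \<in> dissections 0 k m" "xs = glue 0 k (as, bs, cs)"
    by auto
  have so: "sorted_wrt (\<ge>) xs" "\<forall>x\<in>set xs. odd x"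
    using glue_dec_odd[OF p(1) assms(2)] p(2) by auto
  have xs: "xs = as @ bs @ cs" using p(2) by (simp add: glue_def)
  have len: "length as = k" "length bs = m"
    and as: "\<forall>x\<in>set as. 2 * k + 1 \<le> x"
    and bs: "\<forall>x\<in>set bs. 2 * m - 1 \<le> x \<and> x \<le> 2 * k - 1"
    and cs: "\<forall>x\<in>set cs. x < 2 * m"
    using p(1)
    by (auto simp: dissections_def odd_ge_lists_def odd_between_lists_def odd_lists_def dec_lists_def)
  have "2 * k + 1 \<le> part xs k"
    using as len assms part_in_set[of k as] by (auto simp: xs part_append)
  moreover have "part xs (Suc k) < 2 * k + 1"
    using part_less[of "bs @ cs" "2 * k + 1" 1] bs cs assms len
    by (fastforce simp: xs part_append[of as])
  moreover have "m = 0 \<or> 2 * m - 1 \<le> part xs (k + m)"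
    using bs len part_in_set[of m bs] by (auto simp: xs part_append)
  moreover have "part xs (k + Suc m) < 2 * m + 1"
    using part_less[of cs "2 * m + 1" 1] cs len by (fastforce simp: xs part_append)
  ultimately show "xs \<in> type_I_lists k m"
    using so type_I_iff[OF so assms(1)] by (simp add: type_I_lists_def)
next
  fix xs assume xs: "xs \<in> type_I_lists k m"
  then have so: "sorted_wrt (\<ge>) xs" "\<forall>x\<in>set xs. odd x" by (auto simp: type_I_lists_def)
  have c: "2 * k + 1 \<le> part xs k" "part xs (Suc k) < 2 * k + 1"
      "m = 0 \<or> 2 * m - 1 \<le> part xs (k + m)" "part xs (k + Suc m) < 2 * m + 1"
    using xs type_I_iff[OF so assms(1)] by (auto simp: type_I_lists_def)
  show "xs \<in> glue 0 k ` dissections 0 k m"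
  proof (rule glue_surj[OF so])
    show "k + 0 + m \<le> length xs"
      using c(1,3) part_pos_in_set[of xs k] part_pos_in_set[of xs "k + m"]
      by (cases "m = 0") auto
    show "2 * k + 1 \<le> x" if "x \<in> set (take k xs)" for x
      using part_le_take[OF so(1) that] c(1) by simp
    show "2 * (m + 0) - 1 \<le> x \<and> x \<le> 2 * (k + 0) - 1" if x: "x \<in> set (take m (drop (k + 0) xs))" for x
    proof -
      have "x \<in> set (drop k xs)" using x in_set_takeD by fastforce
      then have "x \<le> part xs (Suc k)" "odd x"
        using drop_le_part[OF so(1)] so(2) in_set_dropD by fastforce+
      then have "x \<le> 2 * k - 1" using c(2) by (cases "x = 2 * k") auto
      \<comment> \<open>The first \<open>m\<close> rows below the square are among the first
        \<open>k + m\<close>, so row \<open>k + m\<close> bounds them from below.\<close>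
      moreover have "x \<in> set (take (k + m) xs)" using x by (simp add: take_add)
      then have "2 * m - 1 \<le> x" using part_le_take[OF so(1)] c(3) by fastforce
      ultimately show ?thesis by simp
    qed
    show "x < 2 * (m + 0)" if "x \<in> set (drop (k + 0 + m) xs)" for x
    proof -
      have "x \<le> part xs (k + Suc m)" "odd x"
        using drop_le_part[OF so(1)] so(2) in_set_dropD that by fastforce+
      then show ?thesis using c(4) by (cases "x = 2 * m") auto
    qed
  qed simp
qed

text \<open>Row \<open>Suc h\<close> has length exactly \<open>2 * h + 1\<close>: it forms the
  middle block and, by monotonicity, also gives the upper bound for the block below it.\<close>

lemma glue_type_II:
  assumes "m \<le> h"
  shows "glue 1 h ` dissections 1 h m = type_II_lists (Suc h) m"
proof (intro equalityI subsetI)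
  fix xs assume "xs \<in> glue 1 h ` dissections 1 h m"
  then obtain as bs cs where p: "(as, bs, cs) \<in> dissections 1 h m" "xs = glue 1 h (as, bs, cs)"
    by auto
  have so: "sorted_wrt (\<ge>) xs" "\<forall>x\<in>set xs. odd x"
    using glue_dec_odd[OF p(1) assms] p(2) by auto
  have xs: "xs = as @ [2 * h + 1] @ bs @ cs" using p(2) by (simp add: glue_def)
  have len: "length as = h" "length bs = m"
    and bs: "\<forall>x\<in>set bs. 2 * m + 1 \<le> x"
    and cs: "\<forall>x\<in>set cs. x < 2 * m + 2"
    using p(1)
    by (auto simp: dissections_def odd_ge_lists_def odd_between_lists_def odd_lists_def dec_lists_def)
  have "part xs (Suc h) = 2 * Suc h - 1"
    using len unfolding xs part_append by (simp add: part_def)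
  moreover have "m = 0 \<or> 2 * m + 1 \<le> part xs (Suc h + m)"
    using bs len part_in_set[of m bs] unfolding xs part_append by auto
  moreover have "part xs (Suc h + Suc m) < 2 * m + 3"
    using part_less[of cs "2 * m + 3" 1] cs len unfolding xs part_append by fastforce
  ultimately show "xs \<in> type_II_lists (Suc h) m"
    using so type_II_iff[OF so, of "Suc h" m] by (simp add: type_II_lists_def)
next
  fix xs assume xs: "xs \<in> type_II_lists (Suc h) m"
  then have so: "sorted_wrt (\<ge>) xs" "\<forall>x\<in>set xs. odd x" by (auto simp: type_II_lists_def)
  have c: "part xs (Suc h) = 2 * h + 1"
      "m = 0 \<or> 2 * m + 1 \<le> part xs (Suc h + m)" "part xs (Suc h + Suc m) < 2 * m + 3"
    using xs type_II_iff[OF so, of "Suc h" m] by (auto simp: type_II_lists_def)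
  have len: "Suc h \<le> length xs" using c(1) part_pos_in_set[of xs "Suc h"] by auto
  show "xs \<in> glue 1 h ` dissections 1 h m"
  proof (rule glue_surj[OF so])
    show "h + 1 + m \<le> length xs"
      using len c(2) part_pos_in_set[of xs "Suc h + m"] by (cases "m = 0") auto
    show "take 1 (drop h xs) = replicate 1 (2 * h + 1)"
      using c(1) len by (simp add: part_def take_Suc hd_drop_conv_nth)
    show "2 * h + 1 \<le> x" if "x \<in> set (take h xs)" for x
      using part_le_take[OF so(1), of x "Suc h"] that c(1) set_take_subset_set_take[of h "Suc h" xs]
      by auto
    show "2 * (m + 1) - 1 \<le> x \<and> x \<le> 2 * (h + 1) - 1" if x: "x \<in> set (take m (drop (h + 1) xs))" for x
    proof -
      have "x \<in> set (drop (Suc h) xs)" using x in_set_takeD by fastforce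
      then have "x \<le> part xs (Suc (Suc h))" using drop_le_part[OF so(1)] by blast
      also have "\<dots> \<le> 2 * h + 1" using part_antimono[OF so(1), of "Suc h" "Suc (Suc h)"] c(1) by simp
      finally have "x \<le> 2 * h + 1" .
      moreover have "x \<in> set (take (Suc h + m) xs)" using x unfolding take_add by simp
      then have "2 * m + 1 \<le> x" using part_le_take[OF so(1)] c(2) x by fastforce
      ultimately show ?thesis by simp
    qed
    show "x < 2 * (m + 1)" if "x \<in> set (drop (h + 1 + m) xs)" for x
    proof -
      have "x \<le> part xs (Suc h + Suc m)" "odd x"
        using drop_le_part[OF so(1)] so(2) in_set_dropD that by fastforce+
      then show ?thesis using c(3) by (cases "x = 2 * m + 2") auto
    qed
  qed
qed

text \<open>The exponent collects the minimal row lengths: \<open>h + e\<close> rows of length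
  \<open>2 * h + 1\<close> and \<open>m\<close> rows of length \<open>2 * (m + e) - 1\<close>. The
  remaining factors count what exceeds these minima and the rows below.\<close>

lemma gf_glue:
  assumes "m \<le> h" and "e \<le> 1"
  shows "gf sum_list (glue e h ` dissections e h m) =
    fps_X ^ (h * (2 * h + 1) + e * (2 * h + 1) + m * (2 * (m + e) - 1)) *
    (gf (\<lambda>xs. 2 * sum_list xs) (dec_lists h) *
     (gf (\<lambda>xs. 2 * sum_list xs) (box_lists m (h - m)) * gf sum_list (odd_lists (m + e))))"
proof -
  let ?B = "odd_between_lists m (2 * (m + e) - 1) (2 * (h + e) - 1)"
  have fin: "finite {xs \<in> S. sum_list xs = n}" if "S \<subseteq> dec_lists r" for S r n
    using finite_level_dec_lists[of 1 r n] that
    by (auto intro: finite_subset[of _ "{xs \<in> dec_lists r. sum_list xs = n}"])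
  have finB: "finite {xs \<in> ?B. sum_list xs = n}" for n
    by (rule fin) (auto simp: odd_between_lists_def odd_ge_lists_def)
  \<comment> \<open>The product rule is applied twice, so the inner product needs finite levels:
    both of its weights are at most \<open>n\<close>.\<close>
  have finBO: "finite {p \<in> ?B \<times> odd_lists (m + e). (\<lambda>(bs, cs). sum_list bs + sum_list cs) p = n}" for n
    by (rule finite_subset[of _ "(\<Union>i\<le>n. {xs \<in> ?B. sum_list xs = i}) \<times>
        (\<Union>i\<le>n. {xs \<in> odd_lists (m + e). sum_list xs = i})"])
      (use finB finite_level_odd_lists in auto)
  have "gf sum_list (glue e h ` dissections e h m) = fps_X ^ (e * (2 * h + 1)) *
      gf (\<lambda>(as, q). sum_list as + (\<lambda>(bs, cs). sum_list bs + sum_list cs) q) (dissections e h m)"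
    by (rule gf_bij[OF inj_on_imp_bij_betw[OF inj_glue]])
      (auto simp: glue_def sum_list_replicate algebra_simps)
  also have "gf (\<lambda>(as, q). sum_list as + (\<lambda>(bs, cs). sum_list bs + sum_list cs) q) (dissections e h m) =
      gf sum_list (odd_ge_lists h (2 * h + 1)) *
      gf (\<lambda>(bs, cs). sum_list bs + sum_list cs) (?B \<times> odd_lists (m + e))"
    unfolding dissections_def
    by (rule gf_Times[OF fin finBO]) (auto simp: odd_ge_lists_def)
  also have "gf (\<lambda>(bs, cs). sum_list bs + sum_list cs) (?B \<times> odd_lists (m + e)) =
      gf sum_list ?B * gf sum_list (odd_lists (m + e))"
    by (rule gf_Times[OF finB finite_level_odd_lists])
  also have "gf sum_list ?B =
      fps_X ^ (m * (2 * (m + e) - 1)) * gf (\<lambda>xs. 2 * sum_list xs) (box_lists m (h - m))"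
    by (rule gf_odd_between_lists) (use assms(1) in auto)
  also have "gf sum_list (odd_ge_lists h (2 * h + 1)) =
      fps_X ^ (h * (2 * h + 1)) * gf (\<lambda>xs. 2 * sum_list xs) (dec_lists h)"
    by (rule gf_odd_ge_lists) simp
  finally show ?thesis by (simp only: power_add mult_ac)
qed

section \<open>Comparison of the two generating functions\<close>

text \<open>Among the exponents \<open>1, ..., 2 * m + e\<close>, the even ones give
  \<open>qfact 2 m\<close> and the \<open>m + e\<close> odd ones give the other product.\<close>

lemma qfact_1_split:
  assumes "e \<le> 1"
  shows "qfact 1 (2 * m + e) = qfact 2 m * (\<Prod>i<m + e. 1 - fps_X ^ (2 * i + 1))"
proof -
  have even: "qfact 1 (2 * m) = qfact 2 m * (\<Prod>i<m. 1 - fps_X ^ (2 * i + 1))" for m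
  proof (induction m)
    case (Suc m)
    have eq: "qfact 1 (2 * Suc m) =
        qfact 1 (2 * m) * (1 - fps_X ^ (2 * m + 1)) * (1 - fps_X ^ (2 * Suc m))"
      by (simp add: qfact_Suc)
    show ?case unfolding eq Suc qfact_Suc prod.lessThan_Suc by (simp only: mult_ac)
  qed simp
  have "e = 0 \<or> e = 1" using assms by linarith
  then show ?thesis
  proof
    assume e: "e = 1"
    have odd: "qfact 1 (2 * m + 1) = qfact 1 (2 * m) * (1 - fps_X ^ (2 * m + 1))"
      by (simp add: qfact_Suc)
    have prod: "(\<Prod>i<m + 1. 1 - fps_X ^ (2 * i + 1)) =
        (\<Prod>i<m. 1 - fps_X ^ (2 * i + 1)) * (1 - fps_X ^ (2 * m + 1) :: int fps)"
      by simp
    show ?thesis unfolding e odd even prod by (simp only: mult_ac)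
  qed (simp only: even add_0_right)
qed

text \<open>Both sides become 1 after multiplication by \<open>?c\<close>, which can be cancelled
  because power series over the integers form an integral domain.\<close>

lemma dissection_gf_identity:
  assumes "m \<le> h" and "e \<le> 1"
  shows "gf (\<lambda>xs. 2 * sum_list xs) (dec_lists h) *
     (gf (\<lambda>xs. 2 * sum_list xs) (box_lists m (h - m)) * gf sum_list (odd_lists (m + e))) =
    gf (\<lambda>xs. 1 * sum_list xs) (dec_lists (2 * m + e)) * gf (\<lambda>xs. 2 * sum_list xs) (dec_lists (h - m))"
    (is "?W * (?B * ?O) = ?U * ?V")
proof -
  let ?Q = "\<Prod>i<m + e. 1 - fps_X ^ (2 * i + 1) :: int fps"
  let ?c = "qfact 2 m * qfact 2 (h - m) * ?Q"
  have "?c * (?W * (?B * ?O)) = (qfact 2 m * qfact 2 (h - m) * ?B) * ?W * (?Q * ?O)"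
    by (simp only: mult_ac)
  also have "\<dots> = 1"
    using gf_box_lists[of 2 m "h - m"] gf_dec_lists[of 2 h] gf_odd_lists[of "m + e"] assms(1) by simp
  finally have 1: "?c * (?W * (?B * ?O)) = 1" .
  have "?c * (?U * ?V) = (qfact 1 (2 * m + e) * ?U) * (qfact 2 (h - m) * ?V)"
    unfolding qfact_1_split[OF assms(2)] by (simp only: mult_ac)
  also have "\<dots> = 1"
    using gf_dec_lists[of 1 "2 * m + e"] gf_dec_lists[of 2 "h - m"] by simp
  finally have "?c * (?U * ?V) = ?c * (?W * (?B * ?O))" using 1 by simp
  moreover have "?c \<noteq> 0" using 1 by (metis mult_zero_left zero_neq_one)
  ultimately show ?thesis by simp
qed

text \<open>On the left are the staircase below the distinct parts and the one below the odd values;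
  on the right is the total of the minimal row lengths from \<open>gf_glue\<close>.\<close>

lemma staircase_exponents:
  fixes e h m :: nat
  assumes "e \<le> 1"
  shows "(\<Sum>i<2 * h + e. 1 + i) + (\<Sum>i<2 * m + e. i) =
    h * (2 * h + 1) + e * (2 * h + 1) + m * (2 * (m + e) - 1)"
proof -
  have 1: "(\<Sum>i<2 * h. 1 + i) = h * (2 * h + 1)"
    by (induction h) (auto simp: algebra_simps)
  have 2: "(\<Sum>i<2 * m. i) + m = 2 * m * m"
    by (induction m) (auto simp: algebra_simps)
  \<comment> \<open>The truncation of \<open>2 * m - 1\<close> at \<open>m = 0\<close> is absorbed
    by the factor \<open>m\<close>.\<close>
  have 3: "m * (2 * m - 1) + m = 2 * m * m"
    by (cases m) (auto simp: algebra_simps)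
  have "e = 0 \<or> e = 1" using assms by linarith
  then show ?thesis using 1 2 3 by (auto simp: algebra_simps)
qed

lemma D_eq_dissections:
  assumes "m \<le> h" and "e \<le> 1"
  shows "int (D n (2 * h + e) (2 * m + e)) = fps_nth (gf sum_list (glue e h ` dissections e h m)) n"
proof -
  have "2 * h + e = 2 * m + e + 2 * (h - m)" using assms(1) by simp
  then have "gf sum_list (odd_mult_lists (2 * h + e) (2 * m + e)) = fps_X ^ (\<Sum>i<2 * m + e. i) *
    (gf (\<lambda>xs. 2 * sum_list xs) (dec_lists h) *
     (gf (\<lambda>xs. 2 * sum_list xs) (box_lists m (h - m)) * gf sum_list (odd_lists (m + e))))"
    by (simp only: gf_odd_mult_lists dissection_gf_identity[OF assms])
  then show ?thesis
    unfolding D_eq_coeff gf_glue[OF assms] staircase_exponents[OF assms(2), symmetric]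
    by (simp only: power_add mult.assoc)
qed

lemma D_eq_0: "K < r \<Longrightarrow> D n K r = 0"
proof -
  assume "K < r"
  then have "odd_mult_lists K r = {}" by (auto elim: odd_mult_listsD)
  then have "int (D n K r) = 0" unfolding D_eq_coeff by simp
  then show ?thesis by simp
qed

lemma A1_eq: "A1 n k m = card {xs \<in> type_I_lists k m. sum_list xs = n}"
  unfolding A1_def
  by (rule arg_cong[where f = card])
    (auto simp: type_I_lists_def odd_partitions_of_def partitions_of_def intro: odd_pos)

lemma A2_eq: "A2 n k m = card {xs \<in> type_II_lists k m. sum_list xs = n}"
  unfolding A2_def
  by (rule arg_cong[where f = card])
    (auto simp: type_II_lists_def odd_partitions_of_def partitions_of_def intro: odd_pos)

theorem theorem1p2:
  fixes n k m :: nat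
  assumes "1 \<le> k" and "k \<le> n"
  shows "A1 n k m = D n (2 * k) (2 * m) \<and> A2 n k m = D n (2 * k - 1) (2 * m + 1)"
proof
  show "A1 n k m = D n (2 * k) (2 * m)"
  proof (cases "m \<le> k")
    case True
    then have "int (D n (2 * k) (2 * m)) = int (A1 n k m)"
      using D_eq_dissections[of m k 0 n] glue_type_I[OF assms(1)] by (simp add: gf_nth A1_eq)
    then show ?thesis by simp
  next
    case False
    \<comment> \<open>For \<open>m > k\<close> both counts vanish: no such dissection exists, and
      \<open>2 * k\<close> parts cannot form \<open>2 * m\<close> sequences.\<close>
    then have "type_I_lists k m = {}" using type_I_lists_sub_le[OF _ assms(1)] by blast
    then show ?thesis using False by (simp add: A1_eq D_eq_0)
  qed
  \<comment> \<open>In type II the last row of the Durfee square is its own block, so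
    \<open>h = k - 1\<close> rows remain above it.\<close>
  obtain h where k: "k = Suc h" using assms(1) by (cases k) auto
  show "A2 n k m = D n (2 * k - 1) (2 * m + 1)"
  proof (cases "m \<le> h")
    case True
    then have "int (D n (2 * h + 1) (2 * m + 1)) = int (A2 n k m)"
      using D_eq_dissections[of m h 1 n] glue_type_II by (simp add: gf_nth A2_eq k)
    then show ?thesis by (simp add: k)
  next
    case False
    then have "type_II_lists k m = {}" using type_II_lists_sub_le k by blast
    then show ?thesis using False by (simp add: A2_eq D_eq_0 k)
  qed
qed

end
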